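(* Let $d\ge 1$, let $\mathfrak{m}=(c_0,C,\tilde C,U)\in\mathfrak{M}_d$ with $C=\mathrm{diag}(1,-c_1,\dots,-c_d)$, $\tilde C=\mathrm{diag}(1,-\tilde c_1,\dots,-\tilde c_d)$, $U=(u_{i,j})_{0\le i,j\le d}$, and let $\beta\in\mathbb{C}\setminus(-\mathbb{N}_0)$. For $i\in\{1,\dots,d\}$ define the difference operators $$\mathcal{L}^{x}_{i}=\frac{\tilde c_i}{c_0}\sum_{1\le k\ne l\le d}c_ku_{k,i}u_{l,i}x_l\left(E_{x_k}E_{x_l}^{-1}-\mathrm{Id}\right)-\frac{\tilde c_i}{c_0}\sum_{l=1}^{d}u_{l,i}x_l\left(E_{x_l}^{-1}-\mathrm{Id}\right)-\frac{\tilde c_i}{c_0}\sum_{k=1}^{d}c_ku_{k,i}(\beta+|x|)\left(E_{x_k}-\mathrm{Id}\right)$$ and $$\mathcal{L}^{n}_{i}=\frac{c_i}{c_0}\sum_{1\le k\ne l\le d}\tilde c_ku_{i,k}u_{i,l}n_l\left(E_{n_k}E_{n_l}^{-1}-\mathrm{Id}\right)-\frac{c_i}{c_0}\sum_{l=1}^{d}u_{i,l}n_l\left(E_{n_l}^{-1}-\mathrm{Id}\right)-\frac{c_i}{c_0}\sum_{k=1}^{d}\tilde c_ku_{i,k}(\beta+|n|)\left(E_{n_k}-\mathrm{Id}\right).$$ Then for every $i\in\{1,2,\dots,d\}$, every $n\in\mathbb{N}_0^d$ and every $x\in\mathbb{C}^d$, $$\mathcal{L}^{x}_{i}P_n(x;\mathfrak{m},\beta)=n_i\,P_n(x;\mathfrak{m},\beta),\qquad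 \mathcal{L}^{n}_{i}P_n(x;\mathfrak{m},\beta)=x_i\,P_n(x;\mathfrak{m},\beta).$$
   Context: Notation: $\mathbb{N}_0=\{0,1,2,\dots\}$ and $-\mathbb{N}_0=\{0,-1,-2,\dots\}$. For vectors $z\in\mathbb{C}^d$, $n\in\mathbb{N}_0^d$: $z^n=z_1^{n_1}\cdots z_d^{n_d}$, $n!=n_1!\cdots n_d!$, and $|z|=z_1+\cdots+z_d$ (sum of the coordinates, without absolute values; likewise $|x|$, $|n|$). $(a)_k=a(a+1)\cdots(a+k-1)$, $(a)_0=1$, is the Pochhammer symbol. Complex powers are taken with the principal branch of the logarithm. Shift operators: with $e_1,\dots,e_d$ the standard basis of $\mathbb{C}^d$, $E_{x_i}f(x)=f(x+e_i)$ on functions of $x$, and $E_{n_i}g(n)=g(n+e_i)$ on functions of $n$; $E_{x_i}^{-1}$, $E_{n_i}^{-1}$ are the corresponding backward shifts by $e_i$, and $\mathrm{Id}$ is the identity operator. The coefficients multiply from the left (shift first, then multiply by the coefficient). $\mathcal{L}^n_i$ acts on functions of $n\in\mathbb{N}_0^d$: every term containing $E_{n_l}^{-1}$ is multiplied by $n_l$ and is understood to be $0$ when $n_l=0$. The sum over $1\le k\ne l\le d$ is over all ordered pairs $(k,l)$ with $k,l\in\{1,\dots,d\}$, $k\neq l$. The set $\mathfrak{M}_d$: it consists of all 4-tuples $\mathfrak{m}=(c_0,C,\tilde C,U)$, where $c_0$ is a nonzero complex number and $C,\tilde C,U$ are complex $(d+1)\times(d+1)$ matrices (rows and columns indexed by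 $0,1,\dots,d$) such that (i) $C=\mathrm{diag}(1,-c_1,\dots,-c_d)$ and $\tilde C=\mathrm{diag}(1,-\tilde c_1,\dots,-\tilde c_d)$ are diagonal; (ii) $U=(u_{i,j})_{0\le i,j\le d}$ satisfies $u_{0,j}=u_{j,0}=1$ for all $j=0,1,\dots,d$; (iii) $U^{t}CU\tilde C=c_0I_{d+1}$, where $I_{d+1}$ is the identity matrix. Multivariate Meixner polynomials: for $\mathfrak{m}\in\mathfrak{M}_d$ and $\beta\in\mathbb{C}\setminus(-\mathbb{N}_0)$, the polynomials $P_n(x;\mathfrak{m},\beta)$ in $x=(x_1,\dots,x_d)$, $n\in\mathbb{N}_0^d$, are defined by the expansion, for $z=(z_1,\dots,z_d)$ in a neighborhood of $0$ in $\mathbb{C}^d$, $$(1-|z|)^{-\beta-|x|}\prod_{i=1}^{d}\Big(1-\sum_{j=1}^{d}u_{i,j}z_j\Big)^{x_i}=\sum_{n\in\mathbb{N}_0^d}\frac{(\beta)_{|n|}}{n!}P_n(x;\mathfrak{m},\beta)\,z^n .$$ *)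

theory Defs
  imports "HOL-Analysis.Analysis"
begin

text \<open>
  The index set \<open>{1,\<dots>,d}\<close> is a finite type \<open>'d\<close>, so \<open>d = CARD('d) \<ge> 1\<close>, and \<open>{0,1,\<dots>,d}\<close> is
  \<open>'d option\<close>, where \<open>None\<close> plays the role of the index \<open>0\<close> and \<open>Some i\<close> that of \<open>i\<close>.
\<close>

type_synonym 'd ext_mat = "complex ^ 'd option ^ 'd option"

type_synonym 'd meixner_param = "complex \<times> 'd ext_mat \<times> 'd ext_mat \<times> 'd ext_mat"

text \<open>\<open>diag(1, -c\<^sub>1, \<dots>, -c\<^sub>d)\<close>\<close>

definition neg_diag :: "complex ^ 'd \<Rightarrow> 'd::finite ext_mat" where
  "neg_diag c = (\<chi> i j. if i = j then (case i of None \<Rightarrow> 1 | Some k \<Rightarrow> - (c $ k)) else 0)"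

definition meixner_params :: "'d::finite meixner_param set" where
  "meixner_params = {(c0, C, Ct, U).
     c0 \<noteq> 0 \<and>
     (\<exists>c. C = neg_diag c) \<and> (\<exists>ct. Ct = neg_diag ct) \<and>
     (\<forall>j. U $ None $ j = 1 \<and> U $ j $ None = 1) \<and>
     transpose U ** C ** U ** Ct = mat c0}"

definition vec_sum :: "'a::comm_monoid_add ^ 'd::finite \<Rightarrow> 'a" where
  "vec_sum v = (\<Sum>i\<in>UNIV. v $ i)"

definition multi_fact :: "nat ^ 'd::finite \<Rightarrow> complex" where
  "multi_fact n = (\<Prod>i\<in>UNIV. fact (n $ i))"

definition multi_power :: "complex ^ 'd::finite \<Rightarrow> nat ^ 'd \<Rightarrow> complex" where
  "multi_power z n = (\<Prod>i\<in>UNIV. (z $ i) ^ (n $ i))"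

definition meixner_gen ::
  "'d::finite meixner_param \<Rightarrow> complex \<Rightarrow> complex ^ 'd \<Rightarrow> complex ^ 'd \<Rightarrow> complex" where
  "meixner_gen = (\<lambda>(c0, C, Ct, U) \<beta> x z.
     (1 - vec_sum z) powr (- \<beta> - vec_sum x) *
     (\<Prod>i\<in>UNIV. (1 - (\<Sum>j\<in>UNIV. U $ Some i $ Some j * z $ j)) powr (x $ i)))"

text \<open>
  For fixed \<open>x\<close>, the family \<open>n \<mapsto> P\<^sub>n(x)\<close> is the one whose weighted power series converges
  (unconditionally) to the generating function for all \<open>z\<close> near \<open>0\<close>. It is unique when \<open>\<beta>\<close> is not
  a nonpositive integer, since then no factor \<open>pochhammer \<beta> (vec_sum n)\<close> vanishes.
\<close>

definition meixner_poly ::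
  "'d::finite meixner_param \<Rightarrow> complex \<Rightarrow> nat ^ 'd \<Rightarrow> complex ^ 'd \<Rightarrow> complex" where
  "meixner_poly m \<beta> n x =
     (THE p. \<forall>\<^sub>F z in nhds 0.
        ((\<lambda>k. pochhammer \<beta> (vec_sum k) / multi_fact k * p k * multi_power z k)
           has_sum meixner_gen m \<beta> x z) UNIV) n"

definition fwd_shift :: "'d::finite \<Rightarrow> ('a::semiring_1 ^ 'd \<Rightarrow> complex) \<Rightarrow> 'a ^ 'd \<Rightarrow> complex" where
  "fwd_shift k f v = f (v + axis k 1)"

text \<open>
  On multi-indices the subtraction below truncates at \<open>0\<close>. In \<open>meixner_Ln\<close> every backward shift in
  direction \<open>l\<close> carries the factor \<open>n $ l\<close>, so the truncated value never contributes.
\<close>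

definition bwd_shift ::
  "'d::finite \<Rightarrow> ('a::{semiring_1, minus} ^ 'd \<Rightarrow> complex) \<Rightarrow> 'a ^ 'd \<Rightarrow> complex" where
  "bwd_shift l f v = f (v - axis l 1)"

definition meixner_Lx ::
  "complex \<Rightarrow> complex ^ 'd \<Rightarrow> complex ^ 'd \<Rightarrow> 'd::finite ext_mat \<Rightarrow> complex \<Rightarrow> 'd \<Rightarrow>
     (complex ^ 'd \<Rightarrow> complex) \<Rightarrow> complex ^ 'd \<Rightarrow> complex" where
  "meixner_Lx c0 c ct U \<beta> i f x =
     ct $ i / c0 * (\<Sum>(k, l) \<in> {(k, l). k \<noteq> l}.
        c $ k * U $ Some k $ Some i * U $ Some l $ Some i * x $ l *
          (fwd_shift k (bwd_shift l f) x - f x))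
     - ct $ i / c0 * (\<Sum>l\<in>UNIV. U $ Some l $ Some i * x $ l * (bwd_shift l f x - f x))
     - ct $ i / c0 * (\<Sum>k\<in>UNIV. c $ k * U $ Some k $ Some i * (\<beta> + vec_sum x) *
          (fwd_shift k f x - f x))"

definition meixner_Ln ::
  "complex \<Rightarrow> complex ^ 'd \<Rightarrow> complex ^ 'd \<Rightarrow> 'd::finite ext_mat \<Rightarrow> complex \<Rightarrow> 'd \<Rightarrow>
     (nat ^ 'd \<Rightarrow> complex) \<Rightarrow> nat ^ 'd \<Rightarrow> complex" where
  "meixner_Ln c0 c ct U \<beta> i g n =
     c $ i / c0 * (\<Sum>(k, l) \<in> {(k, l). k \<noteq> l}.
        ct $ k * U $ Some i $ Some k * U $ Some i $ Some l * of_nat (n $ l) *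
          (fwd_shift k (bwd_shift l g) n - g n))
     - c $ i / c0 * (\<Sum>l\<in>UNIV. U $ Some i $ Some l * of_nat (n $ l) * (bwd_shift l g n - g n))
     - c $ i / c0 * (\<Sum>k\<in>UNIV. ct $ k * U $ Some i $ Some k * (\<beta> + of_nat (vec_sum n)) *
          (fwd_shift k g n - g n))"

end

(*
Both eigenvalue equations are read off the generating function G(x, z), whose Taylor coefficients
are the weighted polynomials. A shift of x by e_k multiplies G by w_k/w_0, where w_0 = 1 - |z| and
w_k = 1 - sum_j u_{k,j} z_j, so the operator in x multiplies G by an explicit rational function of z;
the matrix relation identifies it with z_i (d/dz_i G)/G, and z_i d/dz_i multiplies the n-th
coefficient by n_i. On the side of n, forward shifts correspond to d/dz_k and backward shifts to
multiplication by z_l after beta + sum_j z_j d/dz_j, so the operator in n becomes a first-order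
differential operator in z; by the transposed matrix relation it multiplies G by x_i.
*)

theory Submission
  imports Defs "HOL-Complex_Analysis.Cauchy_Integral_Formula"
begin

section \<open>Power series in several complex variables\<close>

text \<open>\<open>meixner_poly\<close> is a definite description, so nothing can be read off before
  two facts hold: the generating function has an unconditionally convergent expansion near 0, and an
  expansion determines its coefficients. Existence is needed only qualitatively, so products and
  powers are expanded over large index sets and regrouped without explicit coefficients. All
  statements concern germs at 0; the radius may depend on x, which does no harm since an operator in
  x involves finitely many shifted arguments. The weight w(n) = (\<beta>)_{|n|}/n! satisfies (n_k+1)
  w(n+e_k) = (\<beta>+|n|) w(n): a derivative brings in \<beta>+|n|, whereas multiplication by z_l
  yields the factor n_l only once \<beta>+|n| has been supplied. As \<beta> is not a nonpositive
  integer, w(n) is never 0 and cancels at the end.\<close>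

definition has_pseries :: "(complex ^ 'd::finite \<Rightarrow> complex) \<Rightarrow> (nat ^ 'd \<Rightarrow> complex) \<Rightarrow> bool" where
  "has_pseries f a \<longleftrightarrow> (\<forall>\<^sub>F z in nhds 0. ((\<lambda>k. a k * multi_power z k) has_sum f z) UNIV)"

lemma norm_multi_power: "norm (multi_power z n) = (\<Prod>i\<in>UNIV. norm (z $ i) ^ (n $ i))"
  by (simp add: multi_power_def prod_norm[symmetric] norm_power)

lemma multi_power_add: "multi_power z (m + n) = multi_power z m * multi_power z n"
  by (simp add: multi_power_def power_add prod.distrib)

lemma multi_power_axis: "multi_power z (axis i 1) = z $ i"
proof -
  have "multi_power z (axis i 1) = (\<Prod>j\<in>UNIV. if j = i then z $ i else 1)"
    unfolding multi_power_def by (rule prod.cong) (auto simp: axis_def)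
  then show ?thesis by simp
qed

text \<open>Closed polydiscs are used because the point with all coordinates equal to r then belongs
  to the domain, and convergence there controls all other points.\<close>

lemma eventually_nhds_0_polydiscE:
  assumes "\<forall>\<^sub>F z :: complex ^ 'd::finite in nhds 0. P z"
  obtains r where "r > 0" "\<And>z. (\<And>i. norm (z $ i) \<le> r) \<Longrightarrow> P z"
proof -
  obtain e where e: "e > 0" "\<And>z :: complex ^ 'd. dist z 0 < e \<Longrightarrow> P z"
    using assms by (auto simp: eventually_nhds_metric)
  define r where "r = e / (2 * real CARD('d))"
  have r: "r > 0" using e(1) by (simp add: r_def)
  moreover have "P z" if z: "\<And>i. norm (z $ i) \<le> r" for z
  proof (rule e(2))
    have "norm z \<le> (\<Sum>i\<in>UNIV. norm (z $ i))" unfolding norm_vec_def by (rule order_trans[OF L2_set_le_sum_abs]) simp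
    also have "\<dots> \<le> (\<Sum>i\<in>(UNIV :: 'd set). r)" by (rule sum_mono) (use z in auto)
    also have "\<dots> < e" using e(1) by (simp add: r_def)
    finally show "dist z 0 < e" by simp
  qed
  ultimately show ?thesis using that by blast
qed

lemma eventually_polydisc:
  assumes "r > 0"
  shows "\<forall>\<^sub>F z :: complex ^ 'd::finite in nhds 0. \<forall>i. norm (z $ i) < r"
  unfolding eventually_nhds_metric
  using assms by (intro exI[of _ r]) (auto intro: le_less_trans[OF Finite_Cartesian_Product.norm_nth_le])

lemma has_pseries_cong:
  assumes "has_pseries f a" "\<forall>\<^sub>F z in nhds 0. f z = g z" "\<And>n. a n = b n"
  shows "has_pseries g b"
proof -
  have "a = b" using assms(3) by blast
  with assms(1,2) show ?thesis
    unfolding has_pseries_def by (auto elim: eventually_elim2)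
qed

lemma has_pseries_0: "has_pseries (\<lambda>_. 0) (\<lambda>_. 0)"
  by (simp add: has_pseries_def)

lemma has_pseries_add:
  assumes "has_pseries f a" "has_pseries g b"
  shows "has_pseries (\<lambda>z. f z + g z) (\<lambda>n. a n + b n)"
  using assms unfolding has_pseries_def
  by eventually_elim (simp add: has_sum_add algebra_simps)

lemma has_pseries_cmult:
  assumes "has_pseries f a"
  shows "has_pseries (\<lambda>z. c * f z) (\<lambda>n. c * a n)"
  using assms unfolding has_pseries_def
  by eventually_elim (simp add: has_sum_cmult_right mult.assoc)

lemma has_pseries_diff:
  assumes "has_pseries f a" "has_pseries g b"
  shows "has_pseries (\<lambda>z. f z - g z) (\<lambda>n. a n - b n)"
  using has_pseries_add[OF assms(1) has_pseries_cmult[OF assms(2), of "-1"]] by simp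

lemma has_pseries_sum:
  assumes "\<And>s. s \<in> S \<Longrightarrow> has_pseries (f s) (a s)"
  shows "has_pseries (\<lambda>z. \<Sum>s\<in>S. f s z) (\<lambda>n. \<Sum>s\<in>S. a s n)"
  using assms
  by (induction S rule: infinite_finite_induct) (auto intro: has_pseries_0 has_pseries_add)

text \<open>The case n_i = 0 is separated because truncated subtraction returns n itself there;
  adding e_i is inverted by subtracting it exactly on the indices with n_i nonzero.\<close>

lemma has_pseries_coord_mult:
  assumes "has_pseries f a"
  shows "has_pseries (\<lambda>z. z $ i * f z) (\<lambda>n. if n $ i = 0 then 0 else a (n - axis i 1))"
  using assms unfolding has_pseries_def
proof eventually_elim
  case (elim z)
  have "((\<lambda>k. z $ i * (a k * multi_power z k)) has_sum z $ i * f z) UNIV"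
    by (intro has_sum_cmult_right elim)
  also have "?this \<longleftrightarrow> ((\<lambda>n. a (n - axis i 1) * multi_power z n) has_sum z $ i * f z) {n. n $ i \<noteq> 0}"
  proof (rule has_sum_reindex_bij_witness[of _ "\<lambda>n. n - axis i 1" "\<lambda>n. n + axis i 1"])
    show "n - axis i 1 + axis i 1 = n" if "n \<in> {n. n $ i \<noteq> 0}" for n :: "nat ^ 'a"
      using that by (auto simp: vec_eq_iff axis_def)
  qed (auto simp: multi_power_add multi_power_axis[unfolded One_nat_def])
  also have "\<dots> \<longleftrightarrow> ?case"
    by (rule has_sum_cong_neutral) auto
  finally show ?case .
qed

text \<open>Unordered summability in the complex numbers is absolute, so convergence at the corner
  (r,...,r) provides one majorant for the whole polydisc.\<close>

lemma has_pseries_abs_summable: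
  assumes "has_pseries f a"
  obtains r where "r > 0"
    "(\<lambda>k. norm (a k) * (\<Prod>i\<in>UNIV. r ^ (k $ i))) summable_on UNIV"
    "\<And>z. (\<And>i. norm (z $ i) \<le> r) \<Longrightarrow> ((\<lambda>k. a k * multi_power z k) has_sum f z) UNIV"
proof -
  obtain r where r: "r > 0"
    "\<And>z. (\<And>i. norm (z $ i) \<le> r) \<Longrightarrow> ((\<lambda>k. a k * multi_power z k) has_sum f z) UNIV"
    using assms unfolding has_pseries_def by (rule eventually_nhds_0_polydiscE) blast
  define z0 :: "complex ^ 'a" where "z0 = (\<chi> i. of_real r)"
  have "(\<lambda>k. a k * multi_power z0 k) summable_on UNIV"
    using r by (intro has_sum_imp_summable[OF r(2)]) (simp add: z0_def)
  then have "(\<lambda>k. norm (a k * multi_power z0 k)) summable_on UNIV"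
    by (simp add: summable_on_iff_abs_summable_on_complex)
  then have "(\<lambda>k. norm (a k) * (\<Prod>i\<in>UNIV. r ^ (k $ i))) summable_on UNIV"
    using r(1) by (simp add: norm_mult norm_multi_power z0_def)
  with r that show ?thesis by blast
qed

lemma multi_power_has_field_derivative:
  "((\<lambda>t. multi_power (z + axis i t) k) has_field_derivative
      of_nat (k $ i) * multi_power (z + axis i t) (k - axis i 1)) (at t)"
proof -
  define Q where "Q = (\<Prod>j\<in>UNIV - {i}. (z $ j) ^ (k $ j))"
  have split: "multi_power (z + axis i t) m = (z $ i + t) ^ (m $ i) * Q"
    if "\<And>j. j \<noteq> i \<Longrightarrow> m $ j = k $ j" for m t
    unfolding multi_power_def Q_def
    by (subst prod.remove[of _ i]) (use that in \<open>auto simp: axis_def intro!: prod.cong\<close>)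
  have 1: "(\<lambda>t. multi_power (z + axis i t) k) = (\<lambda>t. (z $ i + t) ^ (k $ i) * Q)"
    by (rule ext) (rule split, simp)
  have 2: "multi_power (z + axis i t) (k - axis i 1) = (z $ i + t) ^ (k $ i - 1) * Q"
    by (subst split) (auto simp: axis_def)
  show ?thesis unfolding 1 2
    by (auto intro!: derivative_eq_intros)
qed

text \<open>
  Locally uniform convergence along the net of finite partial sums makes the differentiated partial
  sums converge, so the summability of the differentiated series needs no separate estimate.
\<close>

lemma has_pseries_partial:
  assumes f: "has_pseries f a"
    and f': "\<forall>\<^sub>F z in nhds 0. ((\<lambda>t. f (z + axis i t)) has_field_derivative f' z) (at 0)"
  shows "has_pseries f' (\<lambda>n. of_nat (n $ i + 1) * a (n + axis i 1))"
proof -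
  obtain r where r: "r > 0"
    and summ: "(\<lambda>k. norm (a k) * (\<Prod>i\<in>UNIV. r ^ (k $ i))) summable_on UNIV"
    and sum: "\<And>z. (\<And>i. norm (z $ i) \<le> r) \<Longrightarrow> ((\<lambda>k. a k * multi_power z k) has_sum f z) UNIV"
    using has_pseries_abs_summable[OF f] by blast
  \<comment> \<open>Half the radius leaves room to move the i-th coordinate by up to r/2 without
    leaving the polydisc where the majorant applies.\<close>
  have "\<forall>\<^sub>F z :: complex ^ 'a in nhds 0. \<forall>i. norm (z $ i) < r / 2"
    using r by (intro eventually_polydisc) auto
  then show ?thesis
    using f' unfolding has_pseries_def
  proof eventually_elim
    case (elim z)
    define F where "F = finite_subsets_at_top (UNIV :: (nat ^ 'a) set)"
    have in_disc: "norm ((z + axis i t) $ j) \<le> r" if "t \<in> cball 0 (r / 2)" for t j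
    proof -
      have "norm ((z + axis i t) $ j) \<le> norm (z $ j) + norm (axis i t $ j)"
        by (simp add: norm_triangle_ineq)
      also have "norm (axis i t $ j) \<le> r / 2"
        using that r by (auto simp: axis_def)
      finally show ?thesis using elim(1)[rule_format, of j] by simp
    qed
    have "uniform_limit (cball 0 (r / 2)) (\<lambda>X t. \<Sum>k\<in>X. a k * multi_power (z + axis i t) k)
            (\<lambda>t. f (z + axis i t)) F"
      unfolding F_def
    proof (rule Weierstrass_m_test_general'[OF _ _ summ])
      fix k and t :: complex assume t: "t \<in> cball 0 (r / 2)"
      show "norm (a k * multi_power (z + axis i t) k) \<le> norm (a k) * (\<Prod>i\<in>UNIV. r ^ (k $ i))"
        unfolding norm_mult norm_multi_power
        by (intro mult_left_mono prod_mono conjI power_mono in_disc[OF t] zero_le_power norm_ge_zero)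
    qed (rule sum, rule in_disc)
    moreover have "\<forall>\<^sub>F X in F. continuous_on (cball 0 (r / 2)) (\<lambda>t. \<Sum>k\<in>X. a k * multi_power (z + axis i t) k) \<and>
       (\<forall>w\<in>ball 0 (r / 2). ((\<lambda>t. \<Sum>k\<in>X. a k * multi_power (z + axis i t) k) has_field_derivative
          (\<Sum>k\<in>X. a k * (of_nat (k $ i) * multi_power (z + axis i w) (k - axis i 1)))) (at w))"
    proof (intro always_eventually allI conjI ballI)
      fix X w
      show D: "((\<lambda>t. \<Sum>k\<in>X. a k * multi_power (z + axis i t) k) has_field_derivative
          (\<Sum>k\<in>X. a k * (of_nat (k $ i) * multi_power (z + axis i w) (k - axis i 1)))) (at w)" for w
        by (intro DERIV_sum DERIV_cmult multi_power_has_field_derivative)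
      show "continuous_on (cball 0 (r / 2)) (\<lambda>t. \<Sum>k\<in>X. a k * multi_power (z + axis i t) k)"
        by (rule DERIV_continuous_on[OF has_field_derivative_at_within[OF D]])
    qed
    ultimately obtain g' where g': "\<And>w. w \<in> ball 0 (r / 2) \<Longrightarrow>
        ((\<lambda>t. f (z + axis i t)) has_field_derivative g' w) (at w) \<and>
        ((\<lambda>X. \<Sum>k\<in>X. a k * (of_nat (k $ i) * multi_power (z + axis i w) (k - axis i 1))) \<longlongrightarrow> g' w) F"
      using r by (elim has_complex_derivative_uniform_limit[rotated]) (auto simp: F_def)
    have zero: "(0 :: complex) \<in> ball 0 (r / 2)" using r by simp
    have axis_0: "axis i 0 = (0 :: complex ^ 'a)" by (simp add: vec_eq_iff axis_def)
    have "g' 0 = f' z"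
      using g'[OF zero] elim(2) by (blast intro: DERIV_unique)
    then have "((\<lambda>k. a k * (of_nat (k $ i) * multi_power z (k - axis i 1))) has_sum f' z) UNIV"
      using g'[OF zero] unfolding axis_0 by (simp add: has_sum_def F_def)
    also have "?this \<longleftrightarrow> ((\<lambda>k. a k * (of_nat (k $ i) * multi_power z (k - axis i 1))) has_sum f' z) {k. k $ i \<noteq> 0}"
      by (rule has_sum_cong_neutral) auto
    also have "\<dots> \<longleftrightarrow> ?case"
    proof (rule has_sum_reindex_bij_witness[of _ "\<lambda>n. n + axis i 1" "\<lambda>n. n - axis i 1"])
      show "n - axis i 1 + axis i 1 = n" if "n \<in> {n. n $ i \<noteq> 0}" for n :: "nat ^ 'a"
        using that by (auto simp: vec_eq_iff axis_def)
      then show "of_nat ((n - axis i 1) $ i + 1) * a (n - axis i 1 + axis i 1) * multi_power z (n - axis i 1)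
        = a n * (of_nat (n $ i) * multi_power z (n - axis i 1))" if "n \<in> {n. n $ i \<noteq> 0}" for n :: "nat ^ 'a"
        using that by (auto simp: axis_def)
    qed auto
    finally show ?case .
  qed
qed

section \<open>Uniqueness of coefficients\<close>

text \<open>Induction on |n| over all expansions of 0: the constant coefficient is the value at z =
  0, and a coefficient with n_i nonzero is, up to a positive integer factor, a coefficient of lower
  degree of the expansion differentiated in z_i.\<close>

lemma has_pseries_0_imp_coeff_0:
  fixes a :: "nat ^ 'd::finite \<Rightarrow> complex"
  assumes "has_pseries (\<lambda>_. 0) a"
  shows "a n = 0"
  using assms
proof (induction "vec_sum n" arbitrary: a n)
  case 0
  have [simp]: "n = 0" using 0(1) by (simp add: vec_sum_def vec_eq_iff)
  have "((\<lambda>k. a k * multi_power 0 k) has_sum 0) UNIV"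
    using 0(2) unfolding has_pseries_def by (rule eventually_nhds_x_imp_x)
  also have "?this \<longleftrightarrow> ((\<lambda>k. a k * multi_power 0 k) has_sum 0) {0}"
  proof (rule has_sum_cong_neutral)
    fix k :: "nat ^ 'd" assume "k \<in> UNIV - {0}"
    then obtain i where "k $ i \<noteq> 0" by (auto simp: vec_eq_iff)
    then show "a k * multi_power 0 k = 0" 
      by (auto simp: multi_power_def intro!: prod_zero bexI[of _ i])
  qed auto
  finally show ?case by (simp add: has_sum_finite_iff multi_power_def)
next
  case (Suc m)
  then obtain i where i: "n $ i \<noteq> 0"
    by (metis nat.distinct(1) sum.neutral vec_sum_def)
  define n' where "n' = n - axis i 1"
  have n: "n = n' + axis i 1" using i by (auto simp: n'_def vec_eq_iff axis_def)
  have "vec_sum n = vec_sum n' + 1"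
    by (simp add: n vec_sum_def sum.distrib axis_def)
  then have "m = vec_sum n'" using Suc(2) by simp
  moreover have "has_pseries (\<lambda>_. 0) (\<lambda>n. of_nat (n $ i + 1) * a (n + axis i 1))"
    by (rule has_pseries_partial[OF Suc(3)]) simp
  ultimately have "of_nat (n' $ i + 1) * a (n' + axis i 1) = 0"
    by (rule Suc(1))
  then show ?case unfolding n by (metis Suc_eq_plus1 mult_eq_0_iff of_nat_neq_0)
qed

lemma has_pseries_unique:
  assumes "has_pseries f a" "has_pseries g b" "\<forall>\<^sub>F z in nhds 0. f z = g z"
  shows "a n = b n"
proof -
  have "has_pseries (\<lambda>_. 0) (\<lambda>n. a n - b n)"
    by (rule has_pseries_cong[OF has_pseries_diff[OF assms(1,2)]])
       (use assms(3) in \<open>auto elim: eventually_mono\<close>)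
  then show ?thesis using has_pseries_0_imp_coeff_0 by fastforce
qed

section \<open>Existence of expansions: regrouping, products, complex powers of linear forms\<close>

text \<open>The exponent map \<open>\<kappa>\<close> may have infinite fibres.\<close>

lemma has_pseries_regroup:
  fixes \<kappa> :: "'s \<Rightarrow> nat ^ 'd::finite"
  assumes f: "\<forall>\<^sub>F z in nhds 0. ((\<lambda>s. b s * multi_power z (\<kappa> s)) has_sum f z) S"
  shows "\<exists>a. has_pseries f a"
proof -
  define fib where "fib k = {s \<in> S. \<kappa> s = k}" for k
  obtain r where r: "r > 0"
    "\<And>z. (\<And>i. norm (z $ i) \<le> r) \<Longrightarrow> ((\<lambda>s. b s * multi_power z (\<kappa> s)) has_sum f z) S"
    using f by (rule eventually_nhds_0_polydiscE) blast
  define z0 :: "complex ^ 'd" where "z0 = (\<chi> i. of_real r)"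
  \<comment> \<open>On each fibre of \<open>\<kappa>\<close> the monomial at \<open>z0\<close> is a
    fixed nonzero number, so summability at \<open>z0\<close> passes to \<open>b\<close> on that
    fibre.\<close>
  have nz: "multi_power z0 k \<noteq> 0" for k
    using r(1) by (simp add: multi_power_def z0_def)
  have "(\<lambda>s. b s * multi_power z0 (\<kappa> s)) summable_on S"
    using r by (intro has_sum_imp_summable[OF r(2)]) (simp add: z0_def)
  then have "(\<lambda>s. b s * multi_power z0 (\<kappa> s)) summable_on fib k" for k
    by (rule summable_on_subset_banach) (auto simp: fib_def)
  then have "(\<lambda>s. b s * multi_power z0 k) summable_on fib k" for k
    by (rule summable_on_cong[THEN iffD1, rotated]) (auto simp: fib_def)
  then have "b summable_on fib k" for k
    using nz by (simp add: summable_on_cmult_left')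
  then have b: "(b has_sum infsum b (fib k)) (fib k)" for k
    by (rule has_sum_infsum)
  have "has_pseries f (\<lambda>k. infsum b (fib k))"
    using f unfolding has_pseries_def
  proof eventually_elim
    case (elim z)
    also have "((\<lambda>s. b s * multi_power z (\<kappa> s)) has_sum f z) S \<longleftrightarrow>
        ((\<lambda>(k, s). b s * multi_power z k) has_sum f z) (Sigma UNIV fib)"
      by (rule has_sum_reindex_bij_witness[of _ snd "\<lambda>s. (\<kappa> s, s)"]) (auto simp: fib_def)
    finally show ?case
      by (rule has_sum_Sigma') (auto intro: has_sum_cmult_left b)
  qed
  then show ?thesis by blast
qed

text \<open>Both families are absolutely summable, hence so is the product family by iterated sums
  of norms; the iterated value is then the value over the product set.\<close>

lemma has_sum_mult:
  fixes f :: "'a \<Rightarrow> complex" and g :: "'b \<Rightarrow> complex"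
  assumes f: "(f has_sum F) A" and g: "(g has_sum G) B"
  shows "((\<lambda>(x, y). f x * g y) has_sum F * G) (A \<times> B)"
proof -
  have f': "(\<lambda>x. norm (f x)) summable_on A" and g': "(\<lambda>y. norm (g y)) summable_on B"
    using f g by (auto simp: summable_on_iff_abs_summable_on_complex[symmetric] intro: has_sum_imp_summable)
  have "(\<lambda>p. norm ((\<lambda>(x, y). f x * g y) p)) summable_on A \<times> B"
  proof (subst Infinite_Sum.abs_summable_on_Sigma_iff, intro conjI ballI)
    show "(\<lambda>y. norm (case (x, y) of (x, y) \<Rightarrow> f x * g y)) summable_on B" for x
      using summable_on_cmult_right[OF g', of "norm (f x)"] by (simp add: norm_mult)
    have "norm (\<Sum>\<^sub>\<infinity>y\<in>B. norm (case (x, y) of (x, y) \<Rightarrow> f x * g y)) =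
        norm (f x) * (\<Sum>\<^sub>\<infinity>y\<in>B. norm (g y))" for x
      by (simp add: norm_mult infsum_cmult_right' abs_mult infsum_nonneg)
    then show "(\<lambda>x. norm (\<Sum>\<^sub>\<infinity>y\<in>B. norm (case (x, y) of (x, y) \<Rightarrow> f x * g y))) summable_on A"
      using summable_on_cmult_left[OF f'] by simp
  qed
  then have "(\<lambda>(x, y). f x * g y) summable_on A \<times> B"
    by (rule abs_summable_summable)
  then show ?thesis
    by (rule has_sum_SigmaI[where g = "\<lambda>x. f x * G", rotated 2])
       (auto intro: has_sum_cmult_right has_sum_cmult_left f g)
qed

text \<open>Pairs (k, l) with exponent k + l are regrouped, which replaces the Cauchy product
  formula.\<close>

lemma has_pseries_mult_ex:
  assumes "\<exists>a. has_pseries f a" "\<exists>a. has_pseries g a"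
  shows "\<exists>a. has_pseries (\<lambda>z. f z * g z) a"
proof -
  obtain a b where ab: "has_pseries f a" "has_pseries g b" using assms by blast
  show ?thesis
  proof (rule has_pseries_regroup)
    show "\<forall>\<^sub>F z in nhds 0. ((\<lambda>p. (case p of (k, l) \<Rightarrow> a k * b l) *
        multi_power z (case p of (k, l) \<Rightarrow> k + l)) has_sum f z * g z) (UNIV \<times> UNIV)"
      using ab unfolding has_pseries_def
    proof eventually_elim
      case (elim z)
      from has_sum_mult[OF this] show ?case
        by (simp add: multi_power_add mult_ac case_prod_unfold)
    qed
  qed
qed

lemma has_pseries_1: "has_pseries (\<lambda>_. 1) (\<lambda>k. if k = 0 then 1 else 0)"
proof -
  have "((\<lambda>k. (if k = 0 then 1 else 0) * multi_power z k) has_sum 1) UNIV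
    \<longleftrightarrow> ((\<lambda>k. multi_power z k) has_sum 1) {0}" for z :: "complex ^ 'a"
    by (rule has_sum_cong_neutral) auto
  then show ?thesis
    by (simp add: has_pseries_def has_sum_finite_iff multi_power_def)
qed

lemma has_pseries_prod_ex:
  assumes "\<And>s. s \<in> S \<Longrightarrow> \<exists>a. has_pseries (f s) a"
  shows "\<exists>a. has_pseries (\<lambda>z. \<Prod>s\<in>S. f s z) a"
  using assms
  by (induction S rule: infinite_finite_induct) (auto intro: has_pseries_1 has_pseries_mult_ex)

text \<open>The sum of the norms is bounded, not just the norm of the sum: the fully expanded powers
  of the linear form must converge absolutely.\<close>

lemma eventually_linear_form_less:
  fixes u :: "'d::finite \<Rightarrow> complex"
  assumes "e > 0"
  shows "\<forall>\<^sub>F z in nhds 0. (\<Sum>j\<in>UNIV. norm (u j * z $ j)) < e"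
proof -
  have "((\<lambda>z. \<Sum>j\<in>UNIV. norm (u j * z $ j)) \<longlongrightarrow> (\<Sum>j\<in>UNIV. norm (u j * (0 :: complex ^ 'd) $ j))) (nhds 0)"
    by (intro tendsto_intros filterlim_ident)
  then show ?thesis using assms by (intro order_tendstoD(2)[where a=e]) auto
qed

text \<open>
  The \<open>m\<close>-th power of the linear form is expanded as a sum over all maps \<open>{..<m} \<rightarrow> 'd\<close>; collecting
  the maps with equal fibre sizes is left to \<open>has_pseries_regroup\<close>, so no multinomial coefficients occur.
\<close>

lemma has_pseries_linear_powr_ex:
  fixes u :: "'d::finite \<Rightarrow> complex"
  shows "\<exists>a. has_pseries (\<lambda>z. (1 - (\<Sum>j\<in>UNIV. u j * z $ j)) powr s) a"
proof -
  define M where "M m = (PiE {..<m} (\<lambda>_. UNIV) :: (nat \<Rightarrow> 'd) set)" for m :: nat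
  define c where "c m = (s gchoose m) * (- 1) ^ m" for m
  define \<kappa> :: "nat \<times> (nat \<Rightarrow> 'd) \<Rightarrow> nat ^ 'd"
    where "\<kappa> = (\<lambda>(m, h). \<chi> j. card {p \<in> {..<m}. h p = j})"
  define b where "b = (\<lambda>(m, h). c m * (\<Prod>p<m. u (h p)))"
  have fin: "finite (M m)" for m unfolding M_def by (intro finite_PiE) auto
  show ?thesis
  proof (rule has_pseries_regroup)
    show "\<forall>\<^sub>F z in nhds 0. ((\<lambda>s. b s * multi_power z (\<kappa> s)) has_sum
            (1 - (\<Sum>j\<in>UNIV. u j * z $ j)) powr s) (Sigma UNIV M)"
      using eventually_linear_form_less[of 1 u, OF zero_less_one]
    proof eventually_elim
      case (elim z)
      have mp: "multi_power z (\<kappa> (m, h)) = (\<Prod>p<m. z $ h p)" for m h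
      proof -
        have "(\<Prod>p<m. z $ h p) = (\<Prod>j\<in>UNIV. \<Prod>p\<in>{p \<in> {..<m}. h p = j}. z $ h p)"
          by (rule prod.group[symmetric]) auto
        also have "\<dots> = (\<Prod>j\<in>UNIV. (z $ j) ^ card {p \<in> {..<m}. h p = j})"
          by (intro prod.cong refl) simp
        finally show ?thesis by (simp add: multi_power_def \<kappa>_def)
      qed
      have summand: "b (m, h) * multi_power z (\<kappa> (m, h)) = c m * (\<Prod>p<m. u (h p) * z $ h p)" for m h
        by (simp add: mp b_def prod.distrib)
      define y where "y j = u j * z $ j" for j
      \<comment> \<open>Polymorphic in the semiring, since it serves over the complex numbers for
        the value and over the reals for the majorant \<open>q ^ m\<close>.\<close>
      have pow: "(\<Sum>h\<in>M m. \<Prod>p<m. f (h p)) = (\<Sum>j\<in>UNIV. f j) ^ m" for m and f :: "'d \<Rightarrow> 'e::comm_semiring_1"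
        unfolding M_def by (subst prod_sum_PiE[symmetric]) auto
      define q where "q = (\<Sum>j\<in>UNIV. norm (y j))"
      have q: "0 \<le> q" "q < 1" using elim by (auto simp: q_def y_def intro: sum_nonneg)
      have small: "norm (\<Sum>j\<in>UNIV. y j) < 1"
        using norm_sum[of y UNIV] q by (simp add: q_def)
      have summ: "summable (\<lambda>n. norm (c n * of_real t ^ n))" if t: "0 \<le> t" "t < 1" for t :: real
      proof -
        \<comment> \<open>Convergence of the binomial series at a point strictly between t and 1
          gives absolute convergence at t.\<close>
        obtain t' where t': "t < t'" "t' < 1" using dense[OF t(2)] by blast
        have "summable (\<lambda>n. (s gchoose n) * of_real t' ^ n)"
          using gen_binomial_complex[of "of_real t'" s] t' t by (auto simp: sums_iff)
        then have "summable (\<lambda>n. norm ((s gchoose n) * of_real t ^ n))"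
          by (rule powser_insidea) (use t' t in auto)
        then show ?thesis by (simp add: c_def norm_mult norm_power)
      qed
      show ?case
      proof (rule has_sum_SigmaI)
        show "((\<lambda>h. b (m, h) * multi_power z (\<kappa> (m, h))) has_sum c m * (\<Sum>j\<in>UNIV. y j) ^ m) (M m)" for m
          using fin by (simp add: has_sum_finite_iff summand sum_distrib_left[symmetric] pow[symmetric] y_def)
        show "((\<lambda>m. c m * (\<Sum>j\<in>UNIV. y j) ^ m) has_sum (1 - (\<Sum>j\<in>UNIV. u j * z $ j)) powr s) UNIV"
        proof (rule norm_summable_imp_has_sum)
          show "summable (\<lambda>m. norm (c m * (\<Sum>j\<in>UNIV. y j) ^ m))"
            using summ[of "norm (\<Sum>j\<in>UNIV. y j)"] small by (simp add: norm_mult norm_power)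
          show "(\<lambda>m. c m * (\<Sum>j\<in>UNIV. y j) ^ m) sums (1 - (\<Sum>j\<in>UNIV. u j * z $ j)) powr s"
            using gen_binomial_complex[of "- (\<Sum>j\<in>UNIV. y j)" s] small
            by (simp add: c_def y_def power_minus[of "sum _ _"] mult_ac)
        qed
        have "(\<lambda>s. norm (b s * multi_power z (\<kappa> s))) summable_on Sigma UNIV M"
        proof (subst Infinite_Sum.abs_summable_on_Sigma_iff, intro conjI ballI)
          show "(\<lambda>h. norm (b (m, h) * multi_power z (\<kappa> (m, h)))) summable_on M m" for m
            using fin by simp
          have "(\<Sum>\<^sub>\<infinity>h\<in>M m. norm (b (m, h) * multi_power z (\<kappa> (m, h)))) = norm (c m * of_real q ^ m)" for m
          proof -
            have "(\<Sum>h\<in>M m. norm (b (m, h) * multi_power z (\<kappa> (m, h)))) =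
                norm (c m) * (\<Sum>h\<in>M m. \<Prod>p<m. norm (y (h p)))"
              by (simp add: summand norm_mult prod_norm[symmetric] sum_distrib_left y_def)
            also have "(\<Sum>h\<in>M m. \<Prod>p<m. norm (y (h p))) = q ^ m"
              unfolding q_def by (rule pow)
            also have "norm (c m) * q ^ m = norm (c m * of_real q ^ m)"
              using q(1) by (simp add: norm_mult norm_power)
            finally show ?thesis by (simp only: infsum_finite[OF fin])
          qed
          note inner = this
          show "(\<lambda>m. norm (\<Sum>\<^sub>\<infinity>h\<in>M m. norm (b (m, h) * multi_power z (\<kappa> (m, h))))) summable_on UNIV"
            unfolding inner by (rule norm_summable_imp_summable_on) (use summ[OF q] in simp)
        qed
        then show "(\<lambda>s. b s * multi_power z (\<kappa> s)) summable_on Sigma UNIV M"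
          by (rule abs_summable_summable)
      qed
    qed
  qed
qed

section \<open>The generating function and its derivatives\<close>

definition meixner_weight :: "complex \<Rightarrow> nat ^ 'd::finite \<Rightarrow> complex" where
  "meixner_weight \<beta> n = pochhammer \<beta> (vec_sum n) / multi_fact n"

lemma pochhammer_neq_0:
  fixes \<beta> :: complex
  assumes "\<beta> \<notin> \<int>\<^sub>\<le>\<^sub>0"
  shows "pochhammer \<beta> n \<noteq> 0"
  using assms by (auto simp: pochhammer_eq_0_iff)

lemma meixner_weight_neq_0: "\<beta> \<notin> \<int>\<^sub>\<le>\<^sub>0 \<Longrightarrow> meixner_weight \<beta> n \<noteq> 0"
  by (simp add: meixner_weight_def multi_fact_def pochhammer_neq_0)

lemma vec_sum_axis: "vec_sum (n + axis i 1) = Suc (vec_sum n)"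
  by (simp add: vec_sum_def sum.distrib axis_def)

lemma multi_fact_axis: "multi_fact (n + axis i 1) = of_nat (n $ i + 1) * multi_fact n"
proof -
  have "multi_fact (n + axis i 1) = fact (n $ i + 1) * (\<Prod>j\<in>UNIV - {i}. fact (n $ j))"
    unfolding multi_fact_def by (subst prod.remove[of _ i]) (auto simp: axis_def intro!: prod.cong)
  moreover have "multi_fact n = fact (n $ i) * (\<Prod>j\<in>UNIV - {i}. fact (n $ j))"
    unfolding multi_fact_def by (subst prod.remove[of _ i]) auto
  ultimately show ?thesis by simp
qed

lemma meixner_weight_axis:
  "of_nat (n $ i + 1) * meixner_weight \<beta> (n + axis i 1) = (\<beta> + of_nat (vec_sum n)) * meixner_weight \<beta> n"
proof -
  have cancel: "b * (p * q / (b * f)) = q * (p / f)" if "b \<noteq> 0" for b f p q :: complex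
    using that by simp
  show ?thesis
    unfolding meixner_weight_def vec_sum_axis multi_fact_axis pochhammer_Suc
    by (rule cancel) (metis Suc_eq_plus1 of_nat_neq_0)
qed

lemma meixner_gen_has_pseries_ex: "\<exists>a. has_pseries (meixner_gen m \<beta> x) a"
proof -
  obtain c0 C Ct U where m: "m = (c0, C, Ct, U)" by (cases m)
  have "\<exists>a. has_pseries (\<lambda>z. (1 - (\<Sum>j\<in>UNIV. 1 * z $ j)) powr (- \<beta> - vec_sum x) *
     (\<Prod>i\<in>UNIV. (1 - (\<Sum>j\<in>UNIV. U $ Some i $ Some j * z $ j)) powr (x $ i))) a"
    by (intro has_pseries_mult_ex has_pseries_prod_ex has_pseries_linear_powr_ex)
  moreover have "(\<lambda>z. (1 - (\<Sum>j\<in>UNIV. 1 * z $ j)) powr (- \<beta> - vec_sum x) *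
     (\<Prod>i\<in>UNIV. (1 - (\<Sum>j\<in>UNIV. U $ Some i $ Some j * z $ j)) powr (x $ i))) = meixner_gen m \<beta> x"
    by (simp add: fun_eq_iff meixner_gen_def m vec_sum_def)
  ultimately show ?thesis by simp
qed

text \<open>Here the definite description is resolved: dividing any coefficient family by the
  nonzero weights gives a witness, and uniqueness of coefficients makes it the only one.\<close>

lemma meixner_gen_has_pseries:
  assumes "\<beta> \<notin> \<int>\<^sub>\<le>\<^sub>0"
  shows "has_pseries (meixner_gen m \<beta> x) (\<lambda>n. meixner_weight \<beta> n * meixner_poly m \<beta> n x)"
proof -
  define E where "E p = has_pseries (meixner_gen m \<beta> x) (\<lambda>n. meixner_weight \<beta> n * p n)" for p
  obtain a where a: "has_pseries (meixner_gen m \<beta> x) a"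
    using meixner_gen_has_pseries_ex by blast
  have "E (\<lambda>n. a n / meixner_weight \<beta> n)"
    using a assms by (simp add: E_def meixner_weight_neq_0)
  moreover have "p = q" if "E p" "E q" for p q
  proof
    fix n
    have "meixner_weight \<beta> n * p n = meixner_weight \<beta> n * q n"
      using that unfolding E_def by (rule has_pseries_unique) simp
    then show "p n = q n" using assms by (simp add: meixner_weight_neq_0)
  qed
  ultimately have "E (THE p. E p)" by (intro theI'[of E]) blast
  moreover have "meixner_poly m \<beta> n x = (THE p. E p) n" for n
    by (simp add: meixner_poly_def E_def has_pseries_def meixner_weight_def)
  ultimately show ?thesis by (simp add: E_def)
qed

section \<open>Shifts in x and derivatives in z of the generating function\<close>

definition gen_base0 :: "complex ^ 'd::finite \<Rightarrow> complex" where
  "gen_base0 z = 1 - vec_sum z"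

definition gen_base :: "'d::finite ext_mat \<Rightarrow> 'd \<Rightarrow> complex ^ 'd \<Rightarrow> complex" where
  "gen_base U i z = 1 - (\<Sum>j\<in>UNIV. U $ Some i $ Some j * z $ j)"

text \<open>A positive real part keeps w_0 and all w_i nonzero and off the branch cut, so their
  principal powers are differentiable.\<close>

lemma eventually_Re_gen_base_pos:
  "\<forall>\<^sub>F z in nhds 0. Re (gen_base0 z) > 0 \<and> (\<forall>i. Re (gen_base U i z) > 0)"
proof -
  have pos: "Re (1 - (\<Sum>j\<in>UNIV. u j * z $ j)) > 0" if "(\<Sum>j\<in>UNIV. norm (u j * z $ j)) < 1"
    for u :: "'a \<Rightarrow> complex" and z :: "complex ^ 'a"
  proof -
    have "Re (\<Sum>j\<in>UNIV. u j * z $ j) \<le> norm (\<Sum>j\<in>UNIV. u j * z $ j)" by (rule complex_Re_le_cmod)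
    also have "\<dots> \<le> (\<Sum>j\<in>UNIV. norm (u j * z $ j))" by (rule norm_sum)
    finally show ?thesis using that by simp
  qed
  have "\<forall>\<^sub>F z in nhds 0. \<forall>i. (\<Sum>j\<in>UNIV. norm (U $ Some i $ Some j * z $ j)) < 1"
    by (rule eventually_all_finite) (rule eventually_linear_form_less, simp)
  moreover have "\<forall>\<^sub>F z :: complex ^ 'a in nhds 0. (\<Sum>j\<in>UNIV. norm (1 * z $ j)) < 1"
    by (rule eventually_linear_form_less[OF zero_less_one])
  ultimately show ?thesis
  proof eventually_elim
    case (elim z)
    show ?case
      unfolding gen_base0_def gen_base_def vec_sum_def
      using pos[of "\<lambda>_. 1" z] pos[of "\<lambda>j. U $ Some _ $ Some j" z] elim by simp
  qed
qed

lemma meixner_gen_eq: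
  "meixner_gen (c0, C, Ct, U) \<beta> x z = gen_base0 z powr (- \<beta> - vec_sum x) * (\<Prod>i\<in>UNIV. gen_base U i z powr (x $ i))"
  by (simp add: meixner_gen_def gen_base0_def gen_base_def)

lemma prod_powr_add_axis:
  fixes v :: "'d::finite \<Rightarrow> complex"
  assumes "v k \<noteq> 0"
  shows "(\<Prod>i\<in>UNIV. v i powr ((x + axis k 1) $ i)) = (\<Prod>i\<in>UNIV. v i powr (x $ i)) * v k"
proof -
  have "(\<Prod>i\<in>UNIV. v i powr ((x + axis k 1) $ i)) = (\<Prod>i\<in>UNIV. v i powr (x $ i) * (if i = k then v k else 1))"
    using assms by (intro prod.cong) (auto simp: axis_def powr_add)
  then show ?thesis by (simp add: prod.distrib)
qed

text \<open>Since |x| enters through -\<beta>-|x|, raising x_k also lowers the exponent of w_0 by 1.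
  Exponents change by integers, so no branch question arises for nonzero bases.\<close>

lemma meixner_gen_add_axis:
  assumes "gen_base0 z \<noteq> 0" "gen_base U k z \<noteq> 0"
  shows "meixner_gen (c0, C, Ct, U) \<beta> (x + axis k 1) z = meixner_gen (c0, C, Ct, U) \<beta> x z * (gen_base U k z / gen_base0 z)"
proof -
  have s: "- \<beta> - vec_sum (x + axis k 1) = - \<beta> - vec_sum x - 1"
    by (simp add: vec_sum_def sum.distrib axis_def)
  show ?thesis
    unfolding meixner_gen_eq s powr_diff
    using assms by (simp add: prod_powr_add_axis[where v = "\<lambda>i. gen_base U i z", simplified])
qed

lemma meixner_gen_diff_axis:
  assumes "gen_base0 z \<noteq> 0" "gen_base U k z \<noteq> 0"
  shows "meixner_gen (c0, C, Ct, U) \<beta> (x - axis k 1) z = meixner_gen (c0, C, Ct, U) \<beta> x z * (gen_base0 z / gen_base U k z)"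
  using meixner_gen_add_axis[OF assms, of c0 C Ct \<beta> "x - axis k 1"] assms by (simp add: field_simps)

text \<open>Each factor w powr s adds s w'/w to the logarithmic derivative; along the i-th axis w_0
  has slope -1 and w_l has slope -u_{l,i}.\<close>

lemma meixner_gen_partial:
  assumes pos: "Re (gen_base0 z) > 0" "\<And>l. Re (gen_base U l z) > 0"
  shows "((\<lambda>t. meixner_gen (c0, C, Ct, U) \<beta> x (z + axis i t)) has_field_derivative
    meixner_gen (c0, C, Ct, U) \<beta> x z *
      ((\<beta> + vec_sum x) / gen_base0 z - (\<Sum>l\<in>UNIV. x $ l * U $ Some l $ Some i / gen_base U l z))) (at 0)"
proof -
  have base0: "gen_base0 (z + axis i t) = gen_base0 z - t" for t
    by (simp add: gen_base0_def vec_sum_def sum.distrib axis_def)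
  have base: "gen_base U l (z + axis i t) = gen_base U l z - U $ Some l $ Some i * t" for l t
  proof -
    have "(\<Sum>j\<in>UNIV. U $ Some l $ Some j * (z + axis i t) $ j) =
        (\<Sum>j\<in>UNIV. U $ Some l $ Some j * z $ j + (if j = i then U $ Some l $ Some i * t else 0))"
      by (intro sum.cong) (auto simp: axis_def algebra_simps)
    then show ?thesis by (simp add: gen_base_def sum.distrib)
  qed
  have nz: "gen_base0 z \<noteq> 0" "gen_base U l z \<noteq> 0" "gen_base0 z \<notin> \<real>\<^sub>\<le>\<^sub>0" "gen_base U l z \<notin> \<real>\<^sub>\<le>\<^sub>0" for l
    using pos(1) pos(2)[of l] by (auto simp: complex_nonpos_Reals_iff)
  have d0: "((\<lambda>t. (gen_base0 z - t) powr s) has_field_derivative gen_base0 z powr s * (- s / gen_base0 z)) (at 0)" for s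
    using nz(1,3) by (auto intro!: derivative_eq_intros simp: powr_diff)
  have dl: "((\<lambda>t. (gen_base U l z - U $ Some l $ Some i * t) powr s) has_field_derivative
      gen_base U l z powr s * (- s * U $ Some l $ Some i / gen_base U l z)) (at 0)" for l s
    using nz(2,4)[of l] by (auto intro!: derivative_eq_intros simp: powr_diff)
  have dprod: "((\<lambda>t. \<Prod>l\<in>S. (gen_base U l z - U $ Some l $ Some i * t) powr (x $ l)) has_field_derivative
      (\<Prod>l\<in>S. gen_base U l z powr (x $ l)) * (\<Sum>l\<in>S. - (x $ l) * U $ Some l $ Some i / gen_base U l z)) (at 0)" for S
  proof (induction S rule: infinite_finite_induct)
    case (insert l S)
    from DERIV_mult[OF dl[of l "x $ l"] insert.IH] insert.hyps show ?case
      by (simp add: algebra_simps)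
  qed auto
  show ?thesis
    unfolding meixner_gen_eq base0 base
    by (rule DERIV_cong[OF DERIV_mult[OF d0 dprod]])
       (simp add: algebra_simps sum_negf add_divide_distrib)
qed

section \<open>The eigenvalue equations\<close>

lemma sum_option:
  "(\<Sum>e\<in>UNIV. f e) = f None + (\<Sum>i\<in>(UNIV :: 'a::finite set). f (Some i))"
  by (simp add: UNIV_option_conv sum.reindex)

lemma matrix_mult_neg_diag:
  "(A ** neg_diag c) $ a $ b = A $ a $ b * (case b of None \<Rightarrow> 1 | Some k \<Rightarrow> - (c $ k))"
  by (simp add: matrix_matrix_mult_def neg_diag_def if_distrib cong: if_cong)

text \<open>Column i of the relation: by the border of ones, row e reads (1 - sum_k c_k u_{k,i}
  u_{k,e}) (-ct_i). Row 0 and row j give the two sums; the diagonal entry is \<open>c0\<close>,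
  nonzero, so ct_i cannot vanish.\<close>

lemma meixner_orthogonality:
  fixes U :: "'d::finite ext_mat"
  assumes U: "transpose U ** neg_diag c ** U ** neg_diag ct = mat c0"
    and bd: "\<And>j. U $ None $ j = 1" "\<And>j. U $ j $ None = 1" and "c0 \<noteq> 0"
  shows "ct $ i \<noteq> 0"
    and "(\<Sum>k\<in>UNIV. c $ k * U $ Some k $ Some i) = 1"
    and "(\<Sum>k\<in>UNIV. c $ k * U $ Some k $ Some i * U $ Some k $ Some j) = 1 + (if i = j then c0 / ct $ i else 0)"
proof -
  have entry: "(1 - (\<Sum>k\<in>UNIV. c $ k * U $ Some k $ Some i * U $ Some k $ e)) * (- (ct $ i)) =
      (if e = Some i then c0 else 0)" for e
  proof -
    have "(A ** U) $ e $ b = (\<Sum>a\<in>UNIV. A $ e $ a * U $ a $ b)" for A :: "'d ext_mat" and b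
      by (simp add: matrix_matrix_mult_def)
    then have "(transpose U ** neg_diag c ** U ** neg_diag ct) $ e $ Some i =
        (1 - (\<Sum>k\<in>UNIV. c $ k * U $ Some k $ Some i * U $ Some k $ e)) * (- (ct $ i))"
      by (simp add: matrix_mult_neg_diag sum_option transpose_def bd sum_negf mult_ac)
    then show ?thesis
      unfolding U by (simp add: mat_def)
  qed
  show ct: "ct $ i \<noteq> 0" using entry[of "Some i"] assms(4) by auto
  show "(\<Sum>k\<in>UNIV. c $ k * U $ Some k $ Some i) = 1"
    using entry[of None] ct by (simp add: bd)
  show "(\<Sum>k\<in>UNIV. c $ k * U $ Some k $ Some i * U $ Some k $ Some j) = 1 + (if i = j then c0 / ct $ i else 0)"
    using entry[of "Some j"] ct by (auto simp: field_simps)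
qed

text \<open>
  The double transpose is kept so that \<open>meixner_orthogonality\<close> applies verbatim to \<open>transpose U\<close>.
\<close>

lemma meixner_orthogonality_dual:
  fixes U :: "'d::finite ext_mat"
  assumes U: "transpose U ** neg_diag c ** U ** neg_diag ct = mat c0" and "c0 \<noteq> 0"
  shows "transpose (transpose U) ** neg_diag ct ** transpose U ** neg_diag c = mat c0"
proof -
  have mat: "(mat k ** A) $ a $ b = k * A $ a $ b" "(A ** mat k) $ a $ b = A $ a $ b * k"
    for k :: complex and A :: "'d ext_mat" and a b
    by (simp_all add: matrix_matrix_mult_def mat_def if_distrib if_distribR cong: if_cong)
  have mm: "mat k ** mat l = (mat (k * l) :: 'd ext_mat)" for k l
    by (simp add: vec_eq_iff mat) (simp add: mat_def)
  define X where "X = transpose U ** neg_diag c"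
  define Y where "Y = U ** neg_diag ct"
  have "X ** Y = mat c0" using U by (simp add: X_def Y_def matrix_mul_assoc)
  \<comment> \<open>After scaling by 1/c0, a one-sided inverse of a square matrix is two-sided,
    which exchanges the factors X and Y.\<close>
  then have "(mat (1 / c0) ** X) ** Y = mat 1"
    using assms(2) by (simp add: matrix_mul_assoc[symmetric] mm)
  then have "Y ** (mat (1 / c0) ** X) = mat 1"
    by (simp add: matrix_left_right_inverse)
  moreover have "Y ** (mat (1 / c0) ** X) = mat (1 / c0) ** (Y ** X)"
  proof -
    have "Y ** mat (1 / c0) = mat (1 / c0) ** Y" by (simp add: vec_eq_iff mat)
    then show ?thesis by (simp add: matrix_mul_assoc)
  qed
  ultimately have "mat c0 ** (mat (1 / c0) ** (Y ** X)) = mat c0" by (simp add: mm)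
  then have "Y ** X = mat c0" using assms(2) by (simp add: matrix_mul_assoc mm)
  then show ?thesis by (simp add: X_def Y_def matrix_mul_assoc)
qed

text \<open>The sum over k is placed inside because that is the sum which the orthogonality
  relations evaluate.\<close>

lemma sum_off_diagonal:
  fixes F :: "'d::finite \<Rightarrow> 'd \<Rightarrow> complex"
  assumes "\<And>k. F k k = 0"
  shows "(\<Sum>(k, l) \<in> {(k, l). k \<noteq> l}. F k l) = (\<Sum>l\<in>UNIV. \<Sum>k\<in>UNIV. F k l)"
proof -
  have "(\<Sum>(k, l) \<in> {(k, l). k \<noteq> l}. F k l) = (\<Sum>(k, l) \<in> UNIV \<times> UNIV. F k l)"
    by (rule sum.mono_neutral_left) (auto simp: assms)
  also have "\<dots> = (\<Sum>k\<in>UNIV. \<Sum>l\<in>UNIV. F k l)" by (rule sum.cartesian_product[symmetric])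
  also have "\<dots> = (\<Sum>l\<in>UNIV. \<Sum>k\<in>UNIV. F k l)" by (rule sum.swap)
  finally show ?thesis .
qed

section \<open>The operator in x\<close>

lemma meixner_Lx_cmult:
  "meixner_Lx c0 c ct U \<beta> i (\<lambda>y. a * f y) x = a * meixner_Lx c0 c ct U \<beta> i f x"
  by (simp add: meixner_Lx_def fwd_shift_def bwd_shift_def right_diff_distrib sum_distrib_left
      case_prod_unfold mult_ac)

lemma has_pseries_Lx:
  assumes "\<And>y. has_pseries (G y) (\<lambda>n. a n y)"
  shows "has_pseries (\<lambda>z. meixner_Lx c0 c ct U \<beta> i (\<lambda>y. G y z) x) (\<lambda>n. meixner_Lx c0 c ct U \<beta> i (a n) x)"
  unfolding meixner_Lx_def fwd_shift_def bwd_shift_def case_prod_unfold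
  by (intro has_pseries_diff has_pseries_cmult has_pseries_sum assms)

text \<open>The partial derivative in z_k, as the generating function times its logarithmic
  derivative.\<close>

definition meixner_gen_deriv where
  "meixner_gen_deriv m U \<beta> x k z =
     meixner_gen m \<beta> x z * ((\<beta> + vec_sum x) / gen_base0 z - (\<Sum>l\<in>UNIV. x $ l * U $ Some l $ Some k / gen_base U l z))"

lemma has_pseries_meixner_gen_deriv:
  assumes "\<beta> \<notin> \<int>\<^sub>\<le>\<^sub>0"
  shows "has_pseries (meixner_gen_deriv (c0, C, Ct, U) U \<beta> x k)
    (\<lambda>n. meixner_weight \<beta> n * ((\<beta> + of_nat (vec_sum n)) * meixner_poly (c0, C, Ct, U) \<beta> (n + axis k 1) x))"
proof -
  let ?m = "(c0, C, Ct, U)"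
  have "has_pseries (meixner_gen_deriv ?m U \<beta> x k) (\<lambda>n. of_nat (n $ k + 1) *
      (meixner_weight \<beta> (n + axis k 1) * meixner_poly ?m \<beta> (n + axis k 1) x))"
  proof (rule has_pseries_partial[OF meixner_gen_has_pseries[OF assms]])
    show "\<forall>\<^sub>F z in nhds 0. ((\<lambda>t. meixner_gen ?m \<beta> x (z + axis k t)) has_field_derivative
        meixner_gen_deriv ?m U \<beta> x k z) (at 0)"
      using eventually_Re_gen_base_pos[of U] unfolding meixner_gen_deriv_def
      by eventually_elim (rule meixner_gen_partial, auto)
  qed
  then show ?thesis
  proof (rule has_pseries_cong)
    show "of_nat (n $ k + 1) * (meixner_weight \<beta> (n + axis k 1) * meixner_poly ?m \<beta> (n + axis k 1) x) =
        meixner_weight \<beta> n * ((\<beta> + of_nat (vec_sum n)) * meixner_poly ?m \<beta> (n + axis k 1) x)" for n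
      unfolding mult.assoc[symmetric] meixner_weight_axis by (simp only: mult_ac)
  qed simp
qed

text \<open>The weight recursion at n - e_l gives w(n-e_l) (\<beta>+|n|-1) = n_l w(n), which
  explains the factor \<beta>+|n| in the hypothesis. For n_l = 0 the truncated argument of
  \<open>q\<close> is multiplied by 0.\<close>

lemma has_pseries_coord_mult_weight:
  assumes "has_pseries f (\<lambda>n. meixner_weight \<beta> n * ((\<beta> + of_nat (vec_sum n)) * q n))"
  shows "has_pseries (\<lambda>z. z $ l * f z) (\<lambda>n. meixner_weight \<beta> n * (of_nat (n $ l) * q (n - axis l 1)))"
proof (rule has_pseries_cong[OF has_pseries_coord_mult[OF assms]])
  fix n :: "nat ^ 'a"
  show "(if n $ l = 0 then 0 else meixner_weight \<beta> (n - axis l 1) *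
      ((\<beta> + of_nat (vec_sum (n - axis l 1))) * q (n - axis l 1)))
    = meixner_weight \<beta> n * (of_nat (n $ l) * q (n - axis l 1))"
  proof (cases "n $ l = 0")
    case False
    then have n: "n - axis l 1 + axis l 1 = n" "(n - axis l 1) $ l + 1 = n $ l"
      by (auto simp: vec_eq_iff axis_def)
    show ?thesis
      using meixner_weight_axis[of "n - axis l 1" l \<beta>] False unfolding n by (simp add: mult_ac)
  qed simp
qed simp

lemma has_pseries_coord_mult_deriv:
  assumes "\<beta> \<notin> \<int>\<^sub>\<le>\<^sub>0"
  shows "has_pseries (\<lambda>z. z $ l * meixner_gen_deriv (c0, C, Ct, U) U \<beta> x l z)
    (\<lambda>n. meixner_weight \<beta> n * (of_nat (n $ l) * meixner_poly (c0, C, Ct, U) \<beta> n x))"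
proof (rule has_pseries_cong[OF has_pseries_coord_mult_weight[OF has_pseries_meixner_gen_deriv[OF assms]]])
  fix n :: "nat ^ 'a"
  have "n - axis l 1 + axis l 1 = n" if "n $ l \<noteq> 0"
    using that by (auto simp: vec_eq_iff axis_def)
  then show "meixner_weight \<beta> n * (of_nat (n $ l) * meixner_poly (c0, C, Ct, U) \<beta> (n - axis l 1 + axis l 1) x)
    = meixner_weight \<beta> n * (of_nat (n $ l) * meixner_poly (c0, C, Ct, U) \<beta> n x)"
    by (cases "n $ l = 0") simp_all
qed simp

text \<open>All three sums reduce to \<open>K\<close> = sum_k c_k u_{k,i} (w_k - w_0), in which
  orthogonality kills every z_j except z_i. The \<open>K\<close>-free part of the double sum cancels
  against the sum of backward shifts.\<close>

lemma meixner_Lx_gen: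
  assumes nz: "gen_base0 z \<noteq> 0" "\<And>l. gen_base U l z \<noteq> 0" and c0: "c0 \<noteq> 0"
    and orth: "ct $ i \<noteq> 0" "(\<Sum>k\<in>UNIV. c $ k * U $ Some k $ Some i) = 1"
      "\<And>j. (\<Sum>k\<in>UNIV. c $ k * U $ Some k $ Some i * U $ Some k $ Some j) = 1 + (if i = j then c0 / ct $ i else 0)"
  shows "meixner_Lx c0 c ct U \<beta> i (\<lambda>y. meixner_gen (c0, C, Ct, U) \<beta> y z) x
    = z $ i * meixner_gen_deriv (c0, C, Ct, U) U \<beta> x i z"
proof -
  define g where "g = meixner_gen (c0, C, Ct, U) \<beta> x z"
  define u where "u k = U $ Some k $ Some i" for k
  define v where "v k = gen_base U k z" for k
  have nz': "v k \<noteq> 0" for k using nz by (simp add: v_def)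
  have shift: "meixner_gen (c0, C, Ct, U) \<beta> (x + axis k 1) z = g * (v k / gen_base0 z)"
    "meixner_gen (c0, C, Ct, U) \<beta> (x - axis l 1) z = g * (gen_base0 z / v l)"
    "meixner_gen (c0, C, Ct, U) \<beta> (x + axis k 1 - axis l 1) z = g * (v k / v l)" for k l
    using nz by (simp_all add: meixner_gen_add_axis meixner_gen_diff_axis g_def v_def)
  define K where "K = (\<Sum>k\<in>UNIV. c $ k * u k * (v k - gen_base0 z))"
  have K: "K = - (c0 / ct $ i) * z $ i"
  proof -
    have "K = (\<Sum>k\<in>UNIV. \<Sum>j\<in>UNIV. (c $ k * u k - c $ k * u k * U $ Some k $ Some j) * z $ j)"
      by (simp add: K_def v_def gen_base_def gen_base0_def vec_sum_def sum_subtractf[symmetric] sum_distrib_left algebra_simps)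
    also have "\<dots> = (\<Sum>j\<in>UNIV. (\<Sum>k\<in>UNIV. c $ k * u k - c $ k * u k * U $ Some k $ Some j) * z $ j)"
      by (subst sum.swap) (simp add: sum_distrib_right)
    also have "\<dots> = (\<Sum>j\<in>UNIV. if j = i then - (c0 / ct $ i) * z $ i else 0)"
      unfolding sum_subtractf u_def orth by (intro sum.cong) auto
    finally show ?thesis by simp
  qed
  \<comment> \<open>Replacing w_0 by w_l costs only w_0 - w_l because the coefficients c_k u_{k,i}
    sum to 1.\<close>
  have "(\<Sum>k\<in>UNIV. c $ k * u k * (v k - v l)) = K + gen_base0 z - v l" for l
    using orth(2) by (simp add: K_def right_diff_distrib sum_subtractf sum_distrib_right[symmetric] u_def)
  note Kl = this
  have 1: "(\<Sum>(k, l) \<in> {(k, l). k \<noteq> l}. c $ k * u k * u l * x $ l * (g * (v k / v l) - g))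
      = (\<Sum>l\<in>UNIV. u l * x $ l * g / v l * (K + gen_base0 z - v l))"
  proof -
    have "c $ k * u k * u l * x $ l * (g * (v k / v l) - g) = u l * x $ l * g / v l * (c $ k * u k * (v k - v l))" for k l
      using nz'[of l] by (simp add: field_simps)
    then show ?thesis
      using nz' by (subst sum_off_diagonal) (simp, simp only: sum_distrib_left[symmetric] Kl)
  qed
  have 2: "(\<Sum>l\<in>UNIV. u l * x $ l * (g * (gen_base0 z / v l) - g)) = (\<Sum>l\<in>UNIV. u l * x $ l * g / v l * (gen_base0 z - v l))"
    using nz' by (intro sum.cong) (auto simp: field_simps)
  have 3: "(\<Sum>k\<in>UNIV. c $ k * u k * (\<beta> + vec_sum x) * (g * (v k / gen_base0 z) - g)) = (\<beta> + vec_sum x) * g / gen_base0 z * K"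
    using nz(1) by (simp add: K_def sum_distrib_left field_simps)
  have 4: "(\<Sum>l\<in>UNIV. u l * x $ l * g / v l * (K + gen_base0 z - v l)) - (\<Sum>l\<in>UNIV. u l * x $ l * g / v l * (gen_base0 z - v l))
      = K * g * (\<Sum>l\<in>UNIV. x $ l * u l / v l)"
    by (simp add: sum_subtractf[symmetric] sum_distrib_left) (simp add: algebra_simps diff_divide_distrib add_divide_distrib)
  have "meixner_Lx c0 c ct U \<beta> i (\<lambda>y. meixner_gen (c0, C, Ct, U) \<beta> y z) x =
      ct $ i / c0 * (K * g * (\<Sum>l\<in>UNIV. x $ l * u l / v l) - (\<beta> + vec_sum x) * g / gen_base0 z * K)"
    unfolding meixner_Lx_def fwd_shift_def bwd_shift_def shift g_def[symmetric] u_def[symmetric] 1 2 3 4[symmetric]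
    by (simp only: right_diff_distrib)
  also have "\<dots> = z $ i * (g * ((\<beta> + vec_sum x) / gen_base0 z - (\<Sum>l\<in>UNIV. x $ l * u l / v l)))"
    unfolding K using c0 orth(1) nz(1) by (simp add: field_simps)
  finally show ?thesis by (simp add: meixner_gen_deriv_def g_def u_def v_def)
qed

section \<open>The operator in n\<close>

definition meixner_gen_euler where
  "meixner_gen_euler m U \<beta> x z =
     \<beta> * meixner_gen m \<beta> x z + (\<Sum>j\<in>UNIV. z $ j * meixner_gen_deriv m U \<beta> x j z)"

lemma has_pseries_meixner_gen_euler:
  assumes "\<beta> \<notin> \<int>\<^sub>\<le>\<^sub>0"
  shows "has_pseries (meixner_gen_euler (c0, C, Ct, U) U \<beta> x)
    (\<lambda>n. meixner_weight \<beta> n * ((\<beta> + of_nat (vec_sum n)) * meixner_poly (c0, C, Ct, U) \<beta> n x))"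
proof (rule has_pseries_cong)
  show "has_pseries (meixner_gen_euler (c0, C, Ct, U) U \<beta> x)
    (\<lambda>n. \<beta> * (meixner_weight \<beta> n * meixner_poly (c0, C, Ct, U) \<beta> n x) +
      (\<Sum>j\<in>UNIV. meixner_weight \<beta> n * (of_nat (n $ j) * meixner_poly (c0, C, Ct, U) \<beta> n x)))"
    unfolding meixner_gen_euler_def
    by (intro has_pseries_add has_pseries_cmult has_pseries_sum meixner_gen_has_pseries
        has_pseries_coord_mult_deriv assms)
qed (simp_all add: vec_sum_def sum_distrib_left sum_distrib_right algebra_simps)

text \<open>
  The operator \<open>meixner_Ln\<close> acting on the weighted coefficients, written as a differential operator
  in \<open>z\<close>: the shift \<open>n \<mapsto> n + e\<^sub>k - e\<^sub>l\<close> with its factor \<open>n\<^sub>l\<close> becomes \<open>z\<^sub>l \<partial>\<^sub>k\<close> and \<open>\<beta> + |n|\<close> becomes \<open>\<beta> + \<Sum>\<^sub>j z\<^sub>j \<partial>\<^sub>j\<close>.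
\<close>

definition meixner_Ln_gen where
  "meixner_Ln_gen c0 C Ct U c ct \<beta> i x z =
     (let D = (\<lambda>k. meixner_gen_deriv (c0, C, Ct, U) U \<beta> x k z);
          E = meixner_gen_euler (c0, C, Ct, U) U \<beta> x z
      in c $ i / c0 * (\<Sum>(k, l) \<in> {(k, l). k \<noteq> l}.
           ct $ k * U $ Some i $ Some k * U $ Some i $ Some l * (z $ l * D k - z $ l * D l))
         - c $ i / c0 * (\<Sum>l\<in>UNIV. U $ Some i $ Some l * (z $ l * E - z $ l * D l))
         - c $ i / c0 * (\<Sum>k\<in>UNIV. ct $ k * U $ Some i $ Some k * (D k - E)))"

lemma has_pseries_meixner_Ln_gen:
  assumes "\<beta> \<notin> \<int>\<^sub>\<le>\<^sub>0"
  shows "has_pseries (meixner_Ln_gen c0 C Ct U c ct \<beta> i x)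
    (\<lambda>n. meixner_weight \<beta> n * meixner_Ln c0 c ct U \<beta> i (\<lambda>k. meixner_poly (c0, C, Ct, U) \<beta> k x) n)"
proof -
  define p where "p n = meixner_poly (c0, C, Ct, U) \<beta> n x" for n
  note D = has_pseries_meixner_gen_deriv[OF assms, of c0 C Ct U x, folded p_def]
  note zD = has_pseries_coord_mult_weight[OF D]
  note zDl = has_pseries_coord_mult_deriv[OF assms, of _ c0 C Ct U x, folded p_def]
  note E = has_pseries_meixner_gen_euler[OF assms, of c0 C Ct U x, folded p_def]
  note zE = has_pseries_coord_mult_weight[OF E]
  have "has_pseries (meixner_Ln_gen c0 C Ct U c ct \<beta> i x)
    (\<lambda>n. c $ i / c0 * (\<Sum>s \<in> {(k, l). k \<noteq> l}.
           ct $ fst s * U $ Some i $ Some (fst s) * U $ Some i $ Some (snd s) *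
           (meixner_weight \<beta> n * (of_nat (n $ snd s) * p (n - axis (snd s) 1 + axis (fst s) 1))
             - meixner_weight \<beta> n * (of_nat (n $ snd s) * p n)))
         - c $ i / c0 * (\<Sum>l\<in>UNIV. U $ Some i $ Some l *
           (meixner_weight \<beta> n * (of_nat (n $ l) * p (n - axis l 1)) - meixner_weight \<beta> n * (of_nat (n $ l) * p n)))
         - c $ i / c0 * (\<Sum>k\<in>UNIV. ct $ k * U $ Some i $ Some k *
           (meixner_weight \<beta> n * ((\<beta> + of_nat (vec_sum n)) * p (n + axis k 1))
             - meixner_weight \<beta> n * ((\<beta> + of_nat (vec_sum n)) * p n))))"
    unfolding meixner_Ln_gen_def Let_def case_prod_unfold
    by (intro has_pseries_diff has_pseries_cmult has_pseries_sum D E zD zDl zE)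
  \<comment> \<open>The operator adds e_k before subtracting e_l, the series do the reverse; with
    truncation the two agree for k different from l, but not for k = l and n_l = 0.\<close>
  moreover have "n + axis k 1 - axis l 1 = n - axis l 1 + axis k 1" if "k \<noteq> l" for k l and n :: "nat ^ 'a"
    using that by (auto simp: vec_eq_iff axis_def)
  ultimately show ?thesis
    by (elim has_pseries_cong)
       (auto simp: meixner_Ln_def fwd_shift_def bwd_shift_def p_def case_prod_unfold sum_distrib_left
          right_diff_distrib mult_ac intro!: arg_cong2[where f = "(-)"] sum.cong)
qed

text \<open>With \<open>T\<close> = sum_k ct_k u_{i,k} D_k, the terms u_{i,l} z_l D_l cancel between
  the first two sums, leaving a multiple of w_i (\<open>E\<close> - \<open>T\<close>). Orthogonality
  isolates x_i/w_i in \<open>E\<close> - \<open>T\<close>, and w_i cancels.\<close>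

lemma meixner_Ln_gen_eq:
  assumes nz: "gen_base0 z \<noteq> 0" "\<And>l. gen_base U l z \<noteq> 0" and c0: "c0 \<noteq> 0"
    and orth: "c $ i \<noteq> 0" "(\<Sum>k\<in>UNIV. ct $ k * U $ Some i $ Some k) = 1"
      "\<And>l. (\<Sum>k\<in>UNIV. ct $ k * U $ Some i $ Some k * U $ Some l $ Some k) = 1 + (if i = l then c0 / c $ i else 0)"
  shows "meixner_Ln_gen c0 C Ct U c ct \<beta> i x z = x $ i * meixner_gen (c0, C, Ct, U) \<beta> x z"
proof -
  define g where "g = meixner_gen (c0, C, Ct, U) \<beta> x z"
  define u where "u k = U $ Some i $ Some k" for k
  define v where "v k = gen_base U k z" for k
  define D where "D k = meixner_gen_deriv (c0, C, Ct, U) U \<beta> x k z" for k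
  define E where "E = meixner_gen_euler (c0, C, Ct, U) U \<beta> x z"
  define T where "T = (\<Sum>k\<in>UNIV. ct $ k * u k * D k)"
  define B where "B = (\<beta> + vec_sum x) / gen_base0 z"
  have nz': "v k \<noteq> 0" for k using nz by (simp add: v_def)
  have D: "D k = g * (B - (\<Sum>l\<in>UNIV. x $ l / v l * U $ Some l $ Some k))" for k
    by (simp add: D_def meixner_gen_deriv_def g_def B_def v_def)
  \<comment> \<open>Used with q = z to evaluate \<open>E\<close> and with q_k = ct_k u_{i,k} to
    evaluate \<open>T\<close>.\<close>
  have lin: "(\<Sum>k\<in>UNIV. q k * D k) = g * (B * (\<Sum>k\<in>UNIV. q k) -
      (\<Sum>l\<in>UNIV. x $ l / v l * (\<Sum>k\<in>UNIV. q k * U $ Some l $ Some k)))" for q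
  proof -
    have "(\<Sum>k\<in>UNIV. q k * D k) = g * (B * (\<Sum>k\<in>UNIV. q k) -
      (\<Sum>k\<in>UNIV. \<Sum>l\<in>UNIV. x $ l / v l * (q k * U $ Some l $ Some k)))"
      by (simp add: D right_diff_distrib sum_subtractf sum_distrib_left mult_ac)
    then show ?thesis by (subst (asm) sum.swap) (simp add: sum_distrib_left)
  qed
  have E: "E = g * (B - (\<Sum>l\<in>UNIV. x $ l / v l))"
  proof -
    have zw0: "(\<Sum>j\<in>UNIV. z $ j) = 1 - gen_base0 z" by (simp add: gen_base0_def vec_sum_def)
    have zw: "(\<Sum>j\<in>UNIV. z $ j * U $ Some l $ Some j) = 1 - v l" for l
      by (simp add: v_def gen_base_def mult_ac)
    \<comment> \<open>The Euler sum leaves the constant -(\<beta>+|x|) + |x| = -\<beta>, which the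
      summand \<beta> G of \<open>E\<close> removes.\<close>
    have "x $ l / v l * (1 - v l) = x $ l / v l - x $ l" for l
      using nz'[of l] by (simp add: field_simps)
    then have "(\<Sum>j\<in>UNIV. z $ j * D j) = g * (B * (1 - gen_base0 z) - ((\<Sum>l\<in>UNIV. x $ l / v l) - vec_sum x))"
      unfolding lin zw0 zw by (simp add: sum_subtractf vec_sum_def)
    then have "(\<Sum>j\<in>UNIV. z $ j * D j) = g * (B - (\<Sum>l\<in>UNIV. x $ l / v l)) - (B * gen_base0 z - vec_sum x) * g"
      by (simp add: algebra_simps)
    moreover have "B * gen_base0 z - vec_sum x = \<beta>"
      using nz(1) by (simp add: B_def)
    moreover have "E = \<beta> * g + (\<Sum>j\<in>UNIV. z $ j * D j)"
      by (simp add: E_def meixner_gen_euler_def D_def g_def)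
    ultimately show ?thesis by simp
  qed
  have T: "T = E - g * (c0 / c $ i) * (x $ i / v i)"
  proof -
    have "x $ l / v l * (1 + (if i = l then c0 / c $ i else 0)) =
        x $ l / v l + (if l = i then c0 / c $ i * (x $ i / v i) else 0)" for l
      by (simp add: algebra_simps)
    then show ?thesis
      unfolding T_def lin u_def orth E by (simp add: sum.distrib algebra_simps)
  qed
  have uz: "(\<Sum>l\<in>UNIV. u l * z $ l) = 1 - v i" by (simp add: u_def v_def gen_base_def)
  have 1: "(\<Sum>(k, l) \<in> {(k, l). k \<noteq> l}. ct $ k * u k * u l * (z $ l * D k - z $ l * D l))
      = (1 - v i) * T - (\<Sum>l\<in>UNIV. u l * z $ l * D l)"
  proof -
    have "(\<Sum>k\<in>UNIV. ct $ k * u k * u l * (z $ l * D k - z $ l * D l)) = u l * z $ l * T - u l * z $ l * D l" for l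
    proof -
      have "(\<Sum>k\<in>UNIV. ct $ k * u k * u l * (z $ l * D k - z $ l * D l)) =
          u l * z $ l * T - u l * z $ l * D l * (\<Sum>k\<in>UNIV. ct $ k * u k)"
        by (simp add: T_def right_diff_distrib sum_subtractf sum_distrib_left mult_ac)
      then show ?thesis using orth(2) by (simp add: u_def)
    qed
    then show ?thesis
      by (subst sum_off_diagonal) (simp_all add: sum_subtractf sum_distrib_right[symmetric] uz)
  qed
  have 2: "(\<Sum>l\<in>UNIV. u l * (z $ l * E - z $ l * D l)) = (1 - v i) * E - (\<Sum>l\<in>UNIV. u l * z $ l * D l)"
    unfolding uz[symmetric] by (simp add: right_diff_distrib sum_subtractf sum_distrib_left mult_ac)
  have 3: "(\<Sum>k\<in>UNIV. ct $ k * u k * (D k - E)) = T - E"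
    using orth(2) by (simp add: T_def right_diff_distrib sum_subtractf sum_distrib_right[symmetric] u_def)
  have "meixner_Ln_gen c0 C Ct U c ct \<beta> i x z = c $ i / c0 * (v i * (E - T))"
    unfolding meixner_Ln_gen_def Let_def D_def[symmetric] E_def[symmetric] u_def[symmetric] 1 2 3
    using c0 by (simp add: field_simps)
  also have "\<dots> = x $ i * g" unfolding T using nz'[of i] c0 orth(1) by simp
  finally show ?thesis by (simp add: g_def)
qed

theorem theorem4p1:
  fixes c0 \<beta> :: complex
    and C Ct U :: "'d::finite ext_mat"
    and c ct :: "complex ^ 'd"
  assumes "(c0, C, Ct, U) \<in> meixner_params"
    and "C = neg_diag c" and "Ct = neg_diag ct"
    and "\<beta> \<notin> \<int>\<^sub>\<le>\<^sub>0"
  shows "\<forall>(i :: 'd) (n :: nat ^ 'd) (x :: complex ^ 'd).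
     meixner_Lx c0 c ct U \<beta> i (\<lambda>y. meixner_poly (c0, C, Ct, U) \<beta> n y) x
       = of_nat (n $ i) * meixner_poly (c0, C, Ct, U) \<beta> n x \<and>
     meixner_Ln c0 c ct U \<beta> i (\<lambda>k. meixner_poly (c0, C, Ct, U) \<beta> k x) n
       = x $ i * meixner_poly (c0, C, Ct, U) \<beta> n x"
proof (intro allI conjI)
  fix i :: 'd and n :: "nat ^ 'd" and x :: "complex ^ 'd"
  let ?m = "(c0, C, Ct, U)"
  have c0: "c0 \<noteq> 0" and bd: "\<And>j. U $ None $ j = 1" "\<And>j. U $ j $ None = 1"
    and UCU: "transpose U ** neg_diag c ** U ** neg_diag ct = mat c0"
    using assms(1-3) by (auto simp: meixner_params_def)
  note orth = meixner_orthogonality[OF UCU bd c0]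
  have bd': "\<And>j. transpose U $ None $ j = 1" "\<And>j. transpose U $ j $ None = 1"
    using bd by (simp_all add: transpose_def)
  \<comment> \<open>With U transposed and c, ct exchanged this yields c_i nonzero and the sums over
    k of ct_k u_{i,k} and ct_k u_{i,k} u_{l,k}.\<close>
  note orth' = meixner_orthogonality[OF meixner_orthogonality_dual[OF UCU c0] bd' c0,
      unfolded transpose_def, simplified]
  have ev: "\<forall>\<^sub>F z in nhds 0. gen_base0 z \<noteq> 0 \<and> (\<forall>l. gen_base U l z \<noteq> 0)"
    using eventually_Re_gen_base_pos[of U] by eventually_elim (metis less_irrefl zero_complex.sel(1))
  note W = meixner_weight_neq_0[OF assms(4), of n]
  \<comment> \<open>Coefficient comparison sees only the weighted polynomials; the weight is
    independent of x, so it passes through the operator and cancels.\<close>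
  have "meixner_Lx c0 c ct U \<beta> i (\<lambda>y. meixner_weight \<beta> n * meixner_poly ?m \<beta> n y) x =
      meixner_weight \<beta> n * (of_nat (n $ i) * meixner_poly ?m \<beta> n x)"
  proof (rule has_pseries_unique[OF has_pseries_Lx[OF meixner_gen_has_pseries[OF assms(4)]]
        has_pseries_coord_mult_deriv[OF assms(4)]])
    show "\<forall>\<^sub>F z in nhds 0. meixner_Lx c0 c ct U \<beta> i (\<lambda>y. meixner_gen ?m \<beta> y z) x =
        z $ i * meixner_gen_deriv ?m U \<beta> x i z"
      using ev by eventually_elim (rule meixner_Lx_gen, use c0 orth in auto)
  qed
  then show "meixner_Lx c0 c ct U \<beta> i (\<lambda>y. meixner_poly ?m \<beta> n y) x = of_nat (n $ i) * meixner_poly ?m \<beta> n x"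
    using W by (simp add: meixner_Lx_cmult)
  have "meixner_weight \<beta> n * meixner_Ln c0 c ct U \<beta> i (\<lambda>k. meixner_poly ?m \<beta> k x) n =
      x $ i * (meixner_weight \<beta> n * meixner_poly ?m \<beta> n x)"
  proof (rule has_pseries_unique[OF has_pseries_meixner_Ln_gen[OF assms(4)]
        has_pseries_cmult[OF meixner_gen_has_pseries[OF assms(4)]]])
    show "\<forall>\<^sub>F z in nhds 0. meixner_Ln_gen c0 C Ct U c ct \<beta> i x z = x $ i * meixner_gen ?m \<beta> x z"
      using ev by eventually_elim (rule meixner_Ln_gen_eq, use c0 orth' in auto)
  qed
  then show "meixner_Ln c0 c ct U \<beta> i (\<lambda>k. meixner_poly ?m \<beta> k x) n = x $ i * meixner_poly ?m \<beta> n x"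
    using W by simp
qed

end
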